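(* Let $\varphi$ be a lower semicontinuous submeasure on $\mathbb{N}$ with associated analytic $P$-ideal $\mathcal{I}_\varphi$, and let $\{\omega_t\}_{t\in\mathbb{N}}$ be a weighted sequence that is $\mathcal{I}_\varphi$-bounded. Let $K\subset\mathbb{R}$ be compact and let $\{L_t:C(K)\to C(K)\}_{t\in\mathbb{N}}$ be a sequence of positive linear operators. Then (a) for all $f\in C(K)$, the sequence $\{L_t(f)\}_{t\in\mathbb{N}}$ is weighted equi-$\mathcal{I}_\varphi$ convergent to $f$ on $K$ with respect to $\{\omega_t\}$ if and only if (b) for each $i=0,1,2$, the sequence $\{L_t(e_i)\}_{t\in\mathbb{N}}$ is weighted equi-$\mathcal{I}_\varphi$ convergent to $e_i$ on $K$ with respect to $\{\omega_t\}$, where $e_i(x)=x^i$.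
   Context: A sequence $\{\omega_t\}_{t\in\mathbb{N}}$ of real numbers is a weighted sequence if there is $\beta>0$ with $\omega_t>\beta$ for all $t\in\mathbb{N}$. A submeasure on $\mathbb{N}$ is a map $\varphi:\mathcal{P}(\mathbb{N})\to[0,\infty]$ with $\varphi(\varnothing)=0$; $\varphi(A)\le\varphi(B)$ whenever $A\subseteq B$; $\varphi(A\cup B)\le\varphi(A)+\varphi(B)$; and $\varphi(\{t\})<\infty$ for all $t\in\mathbb{N}$. It is lower semicontinuous if $\varphi(A)=\lim_{t\to\infty}\varphi(A\cap[1,t])$ for all $A\subseteq\mathbb{N}$. The associated analytic $P$-ideal is $\mathcal{I}_\varphi=\{A\subseteq\mathbb{N}:\lim_{t\to\infty}\varphi(A\setminus\{1,\dots,t\})=0\}$. $\{\omega_t\}$ is $\mathcal{I}_\varphi$-bounded if there is $\mu>0$ with $\{t\in\mathbb{N}:\omega_t>\mu\}\in\mathcal{I}_\varphi$. $C(K)$ is the space of continuous real-valued functions on $K$. A linear operator $L:C(K)\to C(K)$ is positive if $L(f)\ge0$ whenever $f\ge0$. A sequence $\{f_t\}$ in $C(K)$ is weighted equi-$\mathcal{I}_\varphi$ convergent to $f$ on $K$ with respect to $\{\omega_t\}$ if for every $\varepsilon>0$ the functions $h_{j,\varepsilon}(x)=\varphi\big(\{t\in\mathbb{N}:\omega_t|f_t(x)-f(x)|>\varepsilon\}\setminus[1,j]\big)$, $x\in K$, converge uniformly on $K$ to the zero function as $j\to\infty$. *)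

theory Defs
  imports "HOL-Analysis.Analysis"
begin

text \<open>
  The natural numbers of the source start at 1. They are represented by the carrier
  \<open>{1..}\<close> of type \<^typ>\<open>nat\<close>: conditions on set functions range over subsets of
  \<open>{1..}\<close>, conditions on sequences over indices \<open>t \<ge> 1\<close>, and nothing is required of
  (or depends on) the index 0.
\<close>

definition weighted_seq :: "(nat \<Rightarrow> real) \<Rightarrow> bool" where
  "weighted_seq \<omega> \<longleftrightarrow> (\<exists>\<beta>>0. \<forall>t\<ge>1. \<omega> t > \<beta>)"

definition submeasure :: "(nat set \<Rightarrow> ennreal) \<Rightarrow> bool" where
  "submeasure \<phi> \<longleftrightarrow>
     \<phi> {} = 0 \<and>
     (\<forall>A B. A \<subseteq> B \<and> B \<subseteq> {1..} \<longrightarrow> \<phi> A \<le> \<phi> B) \<and>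
     (\<forall>A B. A \<subseteq> {1..} \<and> B \<subseteq> {1..} \<longrightarrow> \<phi> (A \<union> B) \<le> \<phi> A + \<phi> B) \<and>
     (\<forall>t\<ge>1. \<phi> {t} < \<infinity>)"

definition lsc_submeasure :: "(nat set \<Rightarrow> ennreal) \<Rightarrow> bool" where
  "lsc_submeasure \<phi> \<longleftrightarrow>
     submeasure \<phi> \<and> (\<forall>A\<subseteq>{1..}. (\<lambda>t. \<phi> (A \<inter> {1..t})) \<longlonglongrightarrow> \<phi> A)"

definition analytic_P_ideal :: "(nat set \<Rightarrow> ennreal) \<Rightarrow> nat set set" where
  "analytic_P_ideal \<phi> = {A. A \<subseteq> {1..} \<and> (\<lambda>t. \<phi> (A - {1..t})) \<longlonglongrightarrow> 0}"

definition ideal_bounded :: "(nat set \<Rightarrow> ennreal) \<Rightarrow> (nat \<Rightarrow> real) \<Rightarrow> bool" where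
  "ideal_bounded \<phi> \<omega> \<longleftrightarrow> (\<exists>\<mu>>0. {t\<in>{1..}. \<omega> t > \<mu>} \<in> analytic_P_ideal \<phi>)"

text \<open>
  Elements of \<open>C(K)\<close> are represented by their extensional extensions (constantly
  \<^const>\<open>undefined\<close> outside \<open>K\<close>), so that equality in \<open>C_space K\<close> is equality on \<open>K\<close>,
  and the vector space operations are the pointwise ones restricted to \<open>K\<close>.
\<close>

definition C_space :: "real set \<Rightarrow> (real \<Rightarrow> real) set" where
  "C_space K = {f \<in> extensional K. continuous_on K f}"

definition linear_operator_C :: "real set \<Rightarrow> ((real \<Rightarrow> real) \<Rightarrow> (real \<Rightarrow> real)) \<Rightarrow> bool" where
  "linear_operator_C K L \<longleftrightarrow>
     L \<in> C_space K \<rightarrow> C_space K \<and>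
     (\<forall>f\<in>C_space K. \<forall>g\<in>C_space K.
        L (\<lambda>x\<in>K. f x + g x) = (\<lambda>x\<in>K. L f x + L g x)) \<and>
     (\<forall>c. \<forall>f\<in>C_space K. L (\<lambda>x\<in>K. c * f x) = (\<lambda>x\<in>K. c * L f x))"

definition positive_linear_operator_C ::
    "real set \<Rightarrow> ((real \<Rightarrow> real) \<Rightarrow> (real \<Rightarrow> real)) \<Rightarrow> bool" where
  "positive_linear_operator_C K L \<longleftrightarrow>
     linear_operator_C K L \<and>
     (\<forall>f\<in>C_space K. (\<forall>x\<in>K. f x \<ge> 0) \<longrightarrow> (\<forall>x\<in>K. L f x \<ge> 0))"

definition equi_h ::
    "(nat set \<Rightarrow> ennreal) \<Rightarrow> (nat \<Rightarrow> real) \<Rightarrow> (nat \<Rightarrow> real \<Rightarrow> real) \<Rightarrow> (real \<Rightarrow> real)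
      \<Rightarrow> nat \<Rightarrow> real \<Rightarrow> real \<Rightarrow> ennreal" where
  "equi_h \<phi> \<omega> F f j \<epsilon> x = \<phi> ({t\<in>{1..}. \<omega> t * \<bar>F t x - f x\<bar> > \<epsilon>} - {1..j})"

text \<open>
  Uniform convergence to 0 of the functions \<open>equi_h \<dots> j \<epsilon>\<close> as \<open>j \<rightarrow> \<infinity>\<close> is written out,
  since they take values in \<open>[0, \<infinity>]\<close> and \<^typ>\<open>ennreal\<close> is not a metric space type.
\<close>

definition weighted_equi_convergent ::
    "(nat set \<Rightarrow> ennreal) \<Rightarrow> (nat \<Rightarrow> real) \<Rightarrow> real set \<Rightarrow> (nat \<Rightarrow> real \<Rightarrow> real) \<Rightarrow> (real \<Rightarrow> real) \<Rightarrow> bool"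
  where
  "weighted_equi_convergent \<phi> \<omega> K F f \<longleftrightarrow>
     (\<forall>\<epsilon>>0. \<forall>\<delta>>0. \<forall>\<^sub>F j in sequentially. \<forall>x\<in>K. equi_h \<phi> \<omega> F f j \<epsilon> x < ennreal \<delta>)"

definition monomial_C :: "real set \<Rightarrow> nat \<Rightarrow> real \<Rightarrow> real" where
  "monomial_C K i = (\<lambda>x\<in>K. x ^ i)"

end

theory Submission
  imports Defs
begin

text \<open>
  Only the implication from the three test functions to all of \<open>C(K)\<close> needs an argument: the
  other one holds because the monomials belong to \<open>C(K)\<close>. It is Korovkin's argument, followed
  by a transfer of a pointwise inequality to the submeasure.

  A continuous function on a compact set satisfies
  \<open>\<bar>f y - f x\<bar> \<le> \<eta> + C * (y - x)\<^sup>2\<close> for every \<open>\<eta> > 0\<close>, with \<open>C\<close> depending on \<open>\<eta>\<close>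
  (lemma \<open>continuous_quadratic_modulus\<close>). For a fixed \<open>x\<close> this squeezes \<open>f\<close> between two
  quadratic polynomials in \<open>y\<close>. A positive linear operator preserves the inequalities, and its
  values on quadratic polynomials are determined by those on \<open>e\<^sub>0, e\<^sub>1, e\<^sub>2\<close>. Evaluation at
  \<open>x\<close> yields \<open>\<bar>L f x - f x\<bar> \<le> \<eta> + B * (\<Sum>i\<le>2. \<bar>L e\<^sub>i x - x ^ i\<bar>)\<close> with \<open>B\<close> independent of
  \<open>x\<close> and of \<open>L\<close> (lemmas \<open>korovkin_estimate\<close> and \<open>korovkin_uniform_estimate\<close>).

  Multiplication by \<open>\<omega> t\<close> turns the constant \<open>\<eta>\<close> into \<open>\<omega> t * \<eta>\<close>, and this is where the
  boundedness of \<open>\<omega>\<close> along the ideal enters: outside a set \<open>E\<close> of the ideal, \<open>\<omega> t \<le> \<mu>\<close>, so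
  \<open>\<eta> = \<epsilon> / (2 * \<mu>)\<close> leaves \<open>\<epsilon> / 2\<close> to be exceeded by the other term. Hence the set of indices where
  \<open>L\<^sub>t f\<close> is far from \<open>f\<close> at \<open>x\<close> is covered by \<open>E\<close>, which does not depend on \<open>x\<close>, and by the
  three sets where \<open>L\<^sub>t e\<^sub>i\<close> is far from \<open>e\<^sub>i\<close> at \<open>x\<close>. Subadditivity of the submeasure concludes.
\<close>

section \<open>Positive linear operators on the continuous functions\<close>

lemma C_space_restrictI:
  assumes "continuous_on K f"
  shows "(\<lambda>x\<in>K. f x) \<in> C_space K"
  using assms by (simp add: C_space_def cong: continuous_on_cong)

lemma C_space_continuous: "f \<in> C_space K \<Longrightarrow> continuous_on K f"
  by (simp add: C_space_def)

lemma monomial_C_in_C_space: "monomial_C K i \<in> C_space K"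
  unfolding monomial_C_def by (intro C_space_restrictI continuous_intros)

lemma linear_operator_C_combination:
  assumes L: "linear_operator_C K L" and f: "f \<in> C_space K" and g: "g \<in> C_space K"
    and x: "x \<in> K"
  shows "L (\<lambda>y\<in>K. a * f y + b * g y) x = a * L f x + b * L g x"
proof -
  let ?f = "\<lambda>y\<in>K. a * f y" and ?g = "\<lambda>y\<in>K. b * g y"
  have "?f \<in> C_space K" "?g \<in> C_space K"
    using f g by (auto intro!: C_space_restrictI continuous_intros dest: C_space_continuous)
  then have "L (\<lambda>y\<in>K. ?f y + ?g y) = (\<lambda>y\<in>K. L ?f y + L ?g y)"
    using L unfolding linear_operator_C_def by blast
  moreover have "(\<lambda>y\<in>K. ?f y + ?g y) = (\<lambda>y\<in>K. a * f y + b * g y)"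
    by (auto simp: restrict_def)
  moreover have "L ?f = (\<lambda>y\<in>K. a * L f y)" "L ?g = (\<lambda>y\<in>K. b * L g y)"
    using L f g by (simp_all add: linear_operator_C_def)
  ultimately show ?thesis using x by simp
qed

lemma linear_operator_C_quadratic:
  assumes L: "linear_operator_C K L" and x: "x \<in> K"
  shows "L (\<lambda>y\<in>K. a + b * y + c * y\<^sup>2) x
    = a * L (monomial_C K 0) x + b * L (monomial_C K 1) x + c * L (monomial_C K 2) x"
proof -
  let ?p = "\<lambda>y\<in>K. a * monomial_C K 0 y + b * monomial_C K 1 y"
  have p: "?p \<in> C_space K"
    by (intro C_space_restrictI continuous_intros C_space_continuous monomial_C_in_C_space)
  have "(\<lambda>y\<in>K. a + b * y + c * y\<^sup>2) = (\<lambda>y\<in>K. 1 * ?p y + c * monomial_C K 2 y)"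
    by (auto simp: restrict_def monomial_C_def)
  then show ?thesis
    by (simp only: linear_operator_C_combination[OF L p monomial_C_in_C_space x]
      linear_operator_C_combination[OF L monomial_C_in_C_space monomial_C_in_C_space x])
      simp
qed

lemma positive_linear_operator_C_mono:
  assumes L: "positive_linear_operator_C K L" and f: "f \<in> C_space K" and g: "g \<in> C_space K"
    and le: "\<And>y. y \<in> K \<Longrightarrow> f y \<le> g y" and x: "x \<in> K"
  shows "L f x \<le> L g x"
proof -
  let ?d = "\<lambda>y\<in>K. 1 * g y + (-1) * f y"
  have "?d \<in> C_space K"
    using f g by (intro C_space_restrictI continuous_intros C_space_continuous)
  moreover have "\<forall>y\<in>K. ?d y \<ge> 0" using le by simp
  ultimately have "L ?d x \<ge> 0"
    using L x unfolding positive_linear_operator_C_def by blast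
  moreover have "L ?d x = 1 * L g x + (-1) * L f x"
    using L by (intro linear_operator_C_combination f g x) (simp add: positive_linear_operator_C_def)
  ultimately show ?thesis by simp
qed

section \<open>Korovkin's estimate\<close>

text \<open>
  Nearby points are handled by uniform continuity. For points at distance at least \<open>d\<close>, the
  crude bound \<open>2 * M\<close> is at most \<open>(2 * M / d\<^sup>2) * (y - x)\<^sup>2\<close>.
\<close>

lemma continuous_quadratic_modulus:
  fixes f :: "real \<Rightarrow> real"
  assumes K: "compact K" and f: "continuous_on K f" and "\<eta> > 0"
  obtains C where "C \<ge> 0" "\<And>x y. x \<in> K \<Longrightarrow> y \<in> K \<Longrightarrow> \<bar>f y - f x\<bar> \<le> \<eta> + C * (y - x)\<^sup>2"
proof -
  obtain d where d: "d > 0"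
    and near: "\<And>x y. x \<in> K \<Longrightarrow> y \<in> K \<Longrightarrow> \<bar>y - x\<bar> < d \<Longrightarrow> \<bar>f y - f x\<bar> < \<eta>"
    using compact_uniformly_continuous[OF f K] \<open>\<eta> > 0\<close>
    unfolding uniformly_continuous_on_def dist_real_def by metis
  have "bounded (f ` K)"
    using compact_continuous_image[OF f K] by (rule compact_imp_bounded)
  then obtain M where M: "M > 0" "\<And>x. x \<in> K \<Longrightarrow> \<bar>f x\<bar> \<le> M"
    unfolding bounded_pos by auto
  show thesis
  proof (rule that)
    show "2 * M / d\<^sup>2 \<ge> 0" using M by simp
    fix x y assume xy: "x \<in> K" "y \<in> K"
    show "\<bar>f y - f x\<bar> \<le> \<eta> + 2 * M / d\<^sup>2 * (y - x)\<^sup>2"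
    proof (cases "\<bar>y - x\<bar> < d")
      case True
      moreover have "2 * M / d\<^sup>2 * (y - x)\<^sup>2 \<ge> 0" using M by simp
      ultimately show ?thesis using near[OF xy] by linarith
    next
      case False
      then have "d\<^sup>2 \<le> (y - x)\<^sup>2" using d by (simp add: abs_le_square_iff[symmetric])
      then have "2 * M * d\<^sup>2 \<le> 2 * M * (y - x)\<^sup>2" using M by simp
      then have "2 * M \<le> 2 * M / d\<^sup>2 * (y - x)\<^sup>2" using d by (simp add: field_simps)
      then show ?thesis using M(2)[OF xy(1)] M(2)[OF xy(2)] \<open>\<eta> > 0\<close> by linarith
    qed
  qed
qed

text \<open>
  The bounds \<open>f x \<plusminus> (\<eta> + C * (y - x)\<^sup>2)\<close> are quadratic polynomials in \<open>y\<close>, and the operator acts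
  on \<open>y\<close> while \<open>x\<close> is fixed. With \<open>d\<^sub>i = L e\<^sub>i x - x ^ i\<close>, the polynomial \<open>(y - x)\<^sup>2\<close> is sent
  to a function with value \<open>x\<^sup>2 * d\<^sub>0 - 2 * x * d\<^sub>1 + d\<^sub>2\<close> at \<open>x\<close>, since it vanishes at \<open>x\<close>; the
  three coefficients are at most \<open>(1 + R)\<^sup>2\<close> in absolute value.
\<close>

lemma korovkin_estimate:
  assumes L: "positive_linear_operator_C K L" and f: "f \<in> C_space K"
    and x: "x \<in> K" and R: "\<bar>x\<bar> \<le> R" and M: "\<bar>f x\<bar> \<le> M" and "\<eta> \<ge> 0" "C \<ge> 0"
    and mod: "\<And>y. y \<in> K \<Longrightarrow> \<bar>f y - f x\<bar> \<le> \<eta> + C * (y - x)\<^sup>2"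
  shows "\<bar>L f x - f x\<bar>
    \<le> \<eta> + (M + \<eta> + C * (1 + R)\<^sup>2) * (\<Sum>i\<le>2. \<bar>L (monomial_C K i) x - x ^ i\<bar>)"
proof -
  have lin: "linear_operator_C K L" using L by (simp add: positive_linear_operator_C_def)
  let ?l = "\<lambda>i. L (monomial_C K i) x"
  define d where "d = (\<lambda>i. ?l i - x ^ i)"
  have l: "?l 0 = 1 + d 0" "?l 1 = x + d 1" "?l 2 = x\<^sup>2 + d 2"
    by (simp_all add: d_def)
  let ?P = "\<lambda>s y. (f x + s * (\<eta> + C * x\<^sup>2)) + s * (-2 * C * x) * y + s * C * y\<^sup>2"
  have PC: "(\<lambda>y\<in>K. ?P s y) \<in> C_space K" for s
    by (intro C_space_restrictI continuous_intros)
  have P: "?P s y = f x + s * (\<eta> + C * (y - x)\<^sup>2)" for s y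
    by (simp add: power2_eq_square algebra_simps)
  define q where "q = C * (x\<^sup>2 * d 0 - 2 * x * d 1 + d 2)"
  have LP: "L (\<lambda>y\<in>K. ?P s y) x
      = f x + s * \<eta> + (f x * d 0 + s * (\<eta> * d 0 + q))" for s
    unfolding q_def linear_operator_C_quadratic[OF lin x] l
    by (simp add: power2_eq_square algebra_simps)
  have "L f x \<le> L (\<lambda>y\<in>K. ?P 1 y) x"
  proof (rule positive_linear_operator_C_mono[OF L f PC _ x])
    fix y assume "y \<in> K"
    then show "f y \<le> (\<lambda>y\<in>K. ?P 1 y) y" using mod[of y] unfolding P by simp
  qed
  moreover have "L (\<lambda>y\<in>K. ?P (-1) y) x \<le> L f x"
  proof (rule positive_linear_operator_C_mono[OF L PC f _ x])
    fix y assume "y \<in> K"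
    then show "(\<lambda>y\<in>K. ?P (-1) y) y \<le> f y" using mod[of y] unfolding P by simp
  qed
  ultimately have "\<bar>L f x - f x\<bar> \<le> \<eta> + \<bar>f x * d 0\<bar> + \<bar>\<eta> * d 0\<bar> + \<bar>q\<bar>"
    unfolding LP unfolding mult_1 mult_minus1 by linarith
  also have "\<dots> \<le> \<eta> + M * (\<Sum>i\<le>2. \<bar>d i\<bar>) + \<eta> * (\<Sum>i\<le>2. \<bar>d i\<bar>)
      + C * ((1 + R)\<^sup>2 * (\<Sum>i\<le>2. \<bar>d i\<bar>))"
  proof -
    have S: "(\<Sum>i\<le>2. \<bar>d i\<bar>) = \<bar>d 0\<bar> + \<bar>d 1\<bar> + \<bar>d 2\<bar>"
      by (simp add: numeral_2_eq_2)
    have "0 \<le> R" using R by linarith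
    have x2: "x\<^sup>2 \<le> R\<^sup>2" using R by (metis abs_ge_zero power2_abs power_mono)
    have R2: "(1 + R)\<^sup>2 = 1 + 2 * R + R\<^sup>2" by (simp add: power2_eq_square algebra_simps)
    have "\<bar>f x * d 0\<bar> \<le> M * (\<Sum>i\<le>2. \<bar>d i\<bar>)"
      unfolding abs_mult using M by (intro mult_mono) (auto simp: S)
    moreover have "\<bar>\<eta> * d 0\<bar> \<le> \<eta> * (\<Sum>i\<le>2. \<bar>d i\<bar>)"
      unfolding abs_mult using \<open>\<eta> \<ge> 0\<close> by (intro mult_mono) (auto simp: S)
    moreover have "\<bar>x\<^sup>2 * d 0 - 2 * x * d 1 + d 2\<bar> \<le> (1 + R)\<^sup>2 * (\<Sum>i\<le>2. \<bar>d i\<bar>)"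
    proof -
      have "\<bar>x\<^sup>2 * d 0\<bar> \<le> (1 + R)\<^sup>2 * \<bar>d 0\<bar>"
        unfolding abs_mult using x2 \<open>0 \<le> R\<close> by (intro mult_right_mono) (auto simp: R2)
      moreover have "\<bar>2 * x * d 1\<bar> \<le> (1 + R)\<^sup>2 * \<bar>d 1\<bar>"
      proof -
        have "\<bar>2 * x\<bar> \<le> (1 + R)\<^sup>2"
          unfolding R2 using R zero_le_power2[of R] by linarith
        then show ?thesis unfolding abs_mult[of "2 * x"] by (simp add: mult_right_mono)
      qed
      moreover have "1 * \<bar>d 2\<bar> \<le> (1 + R)\<^sup>2 * \<bar>d 2\<bar>"
        using \<open>0 \<le> R\<close> by (intro mult_right_mono) (auto simp: R2)
      ultimately show ?thesis unfolding S distrib_left by linarith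
    qed
    then have "\<bar>q\<bar> \<le> C * ((1 + R)\<^sup>2 * (\<Sum>i\<le>2. \<bar>d i\<bar>))"
      unfolding q_def abs_mult using \<open>C \<ge> 0\<close> by (simp add: mult_left_mono)
    ultimately show ?thesis by linarith
  qed
  also have "\<dots> = \<eta> + (M + \<eta> + C * (1 + R)\<^sup>2) * (\<Sum>i\<le>2. \<bar>d i\<bar>)"
    by (simp add: algebra_simps)
  finally show ?thesis by (simp add: d_def)
qed

lemma korovkin_uniform_estimate:
  assumes K: "compact K" and f: "f \<in> C_space K" and "\<eta> > 0"
  obtains B where "B > 0" "\<And>L x. positive_linear_operator_C K L \<Longrightarrow> x \<in> K \<Longrightarrow>
    \<bar>L f x - f x\<bar> \<le> \<eta> + B * (\<Sum>i\<le>2. \<bar>L (monomial_C K i) x - monomial_C K i x\<bar>)"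
proof -
  have cont: "continuous_on K f" by (rule C_space_continuous[OF f])
  obtain C where C: "C \<ge> 0" "\<And>x y. x \<in> K \<Longrightarrow> y \<in> K \<Longrightarrow> \<bar>f y - f x\<bar> \<le> \<eta> + C * (y - x)\<^sup>2"
    using continuous_quadratic_modulus[OF K cont \<open>\<eta> > 0\<close>] by blast
  obtain R where R: "R > 0" "\<And>x. x \<in> K \<Longrightarrow> \<bar>x\<bar> \<le> R"
    using compact_imp_bounded[OF K] unfolding bounded_pos by auto
  obtain M where M: "M > 0" "\<And>x. x \<in> K \<Longrightarrow> \<bar>f x\<bar> \<le> M"
    using compact_imp_bounded[OF compact_continuous_image[OF cont K]] unfolding bounded_pos by auto
  show thesis
  proof (rule that)
    show "M + \<eta> + C * (1 + R)\<^sup>2 > 0" using M \<open>\<eta> > 0\<close> C by (simp add: add_pos_nonneg)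
    fix L x assume L: "positive_linear_operator_C K L" and x: "x \<in> K"
    show "\<bar>L f x - f x\<bar> \<le> \<eta> + (M + \<eta> + C * (1 + R)\<^sup>2)
        * (\<Sum>i\<le>2. \<bar>L (monomial_C K i) x - monomial_C K i x\<bar>)"
      using korovkin_estimate[OF L f x R(2)[OF x] M(2)[OF x] _ C(1) C(2)[OF x]] \<open>\<eta> > 0\<close> x
      by (simp add: monomial_C_def)
  qed
qed

section \<open>Transfer to the submeasure\<close>

lemma submeasure_Un_lt:
  assumes "submeasure \<phi>" "A \<subseteq> {1..}" "B \<subseteq> {1..}"
    and "\<phi> A < ennreal a" "\<phi> B < ennreal b" "a \<ge> 0" "b \<ge> 0"
  shows "\<phi> (A \<union> B) < ennreal (a + b)"
proof -
  have "\<phi> (A \<union> B) \<le> \<phi> A + \<phi> B" using assms(1-3) by (simp add: submeasure_def)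
  also have "\<dots> < ennreal a + ennreal b" using assms(4,5) by (rule add_strict_mono)
  finally show ?thesis using assms(6,7) by simp
qed

text \<open>
  The transfer from a pointwise inequality to equi-convergence, for an arbitrary family \<open>F\<close>: if the
  weighted sum of the three deviations exceeds \<open>\<epsilon> / (2 * B)\<close>, one of them exceeds
  \<open>\<epsilon> / (6 * B)\<close>. The four covering sets receive a quarter of \<open>\<delta>\<close> each. The constant \<open>B\<close> may
  depend on \<open>\<eta>\<close>, since \<open>\<eta>\<close> is fixed by \<open>\<epsilon>\<close> and the bound on the weights alone.
\<close>

lemma weighted_equi_convergent_by_estimate:
  assumes sub: "submeasure \<phi>" and w: "weighted_seq \<omega>" and bdd: "ideal_bounded \<phi> \<omega>"
    and conv: "\<And>i. i \<in> {0,1,2::nat} \<Longrightarrow> weighted_equi_convergent \<phi> \<omega> K (G i) (g i)"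
    and est: "\<And>\<eta>. \<eta> > 0 \<Longrightarrow> \<exists>B>0. \<forall>t\<ge>1. \<forall>x\<in>K.
      \<bar>F t x - f x\<bar> \<le> \<eta> + B * (\<Sum>i\<le>2. \<bar>G i t x - g i x\<bar>)"
  shows "weighted_equi_convergent \<phi> \<omega> K F f"
  unfolding weighted_equi_convergent_def
proof (intro allI impI)
  fix \<epsilon> \<delta> :: real assume "\<epsilon> > 0" "\<delta> > 0"
  obtain \<mu> where "\<mu> > 0" and \<mu>: "{t\<in>{1..}. \<omega> t > \<mu>} \<in> analytic_P_ideal \<phi>"
    using bdd unfolding ideal_bounded_def by blast
  define E where "E = {t\<in>{1..}. \<omega> t > \<mu>}"
  have "\<epsilon> / (2 * \<mu>) > 0" using \<open>\<epsilon> > 0\<close> \<open>\<mu> > 0\<close> by simp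
  from est[OF this] obtain B where "B > 0" and B: "\<And>t x. t \<ge> 1 \<Longrightarrow> x \<in> K \<Longrightarrow>
      \<bar>F t x - f x\<bar> \<le> \<epsilon> / (2 * \<mu>) + B * (\<Sum>i\<le>2. \<bar>G i t x - g i x\<bar>)"
    by blast
  define \<epsilon>' where "\<epsilon>' = \<epsilon> / (6 * B)"
  have "\<epsilon>' > 0" using \<open>\<epsilon> > 0\<close> \<open>B > 0\<close> by (simp add: \<epsilon>'_def)
  define D where "D = (\<lambda>i x. {t\<in>{1..}. \<omega> t * \<bar>G i t x - g i x\<bar> > \<epsilon>'})"
  have cover: "{t\<in>{1..}. \<omega> t * \<bar>F t x - f x\<bar> > \<epsilon>} \<subseteq> E \<union> D 0 x \<union> (D 1 x \<union> D 2 x)"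
    if x: "x \<in> K" for x
  proof (rule subsetI, rule ccontr)
    fix t assume t: "t \<in> {t\<in>{1..}. \<omega> t * \<bar>F t x - f x\<bar> > \<epsilon>}"
      and "t \<notin> E \<union> D 0 x \<union> (D 1 x \<union> D 2 x)"
    then have t1: "t \<ge> 1" and le: "\<omega> t \<le> \<mu>"
      and small: "\<omega> t * \<bar>G 0 t x - g 0 x\<bar> \<le> \<epsilon>'" "\<omega> t * \<bar>G 1 t x - g 1 x\<bar> \<le> \<epsilon>'"
        "\<omega> t * \<bar>G 2 t x - g 2 x\<bar> \<le> \<epsilon>'"
      by (auto simp: E_def D_def)
    have pos: "\<omega> t > 0" using w t1 unfolding weighted_seq_def by (meson order_less_trans)
    have "\<omega> t * \<bar>F t x - f x\<bar> \<le> \<omega> t * (\<epsilon> / (2 * \<mu>) + B * (\<Sum>i\<le>2. \<bar>G i t x - g i x\<bar>))"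
      using B[OF t1 x] pos by simp
    also have "\<dots> = \<omega> t * (\<epsilon> / (2 * \<mu>)) + B * (\<Sum>i\<le>2. \<omega> t * \<bar>G i t x - g i x\<bar>)"
      by (simp add: algebra_simps sum_distrib_left)
    also have "\<dots> \<le> \<mu> * (\<epsilon> / (2 * \<mu>)) + B * (3 * \<epsilon>')"
    proof (rule add_mono)
      show "\<omega> t * (\<epsilon> / (2 * \<mu>)) \<le> \<mu> * (\<epsilon> / (2 * \<mu>))"
        using le \<open>\<epsilon> / (2 * \<mu>) > 0\<close> by (intro mult_right_mono) auto
      have "(\<Sum>i\<le>2. \<omega> t * \<bar>G i t x - g i x\<bar>) \<le> 3 * \<epsilon>'"
        using small by (simp add: numeral_2_eq_2)
      then show "B * (\<Sum>i\<le>2. \<omega> t * \<bar>G i t x - g i x\<bar>) \<le> B * (3 * \<epsilon>')"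
        using \<open>B > 0\<close> by simp
    qed
    also have "\<dots> = \<epsilon>" using \<open>\<mu> > 0\<close> \<open>B > 0\<close> by (simp add: \<epsilon>'_def field_simps)
    finally show False using t by simp
  qed
  have "(\<lambda>j. \<phi> (E - {1..j})) \<longlonglongrightarrow> 0"
    using \<mu> by (simp add: analytic_P_ideal_def E_def)
  then have "\<forall>\<^sub>F j in sequentially. \<phi> (E - {1..j}) < ennreal (\<delta> / 4)"
    using \<open>\<delta> > 0\<close> by (simp add: order_tendstoD)
  moreover have "\<forall>\<^sub>F j in sequentially. \<forall>x\<in>K. \<phi> (D i x - {1..j}) < ennreal (\<delta> / 4)"
    if "i \<in> {0,1,2}" for i
    using conv[OF that] \<open>\<epsilon>' > 0\<close> \<open>\<delta> > 0\<close>
    unfolding weighted_equi_convergent_def equi_h_def D_def by simp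
  from this[of 0] this[of 1] this[of 2]
  have "\<forall>\<^sub>F j in sequentially. \<forall>x\<in>K. \<phi> (D 0 x - {1..j}) < ennreal (\<delta> / 4)"
    "\<forall>\<^sub>F j in sequentially. \<forall>x\<in>K. \<phi> (D 1 x - {1..j}) < ennreal (\<delta> / 4)"
    "\<forall>\<^sub>F j in sequentially. \<forall>x\<in>K. \<phi> (D 2 x - {1..j}) < ennreal (\<delta> / 4)"
    by simp_all
  ultimately show "\<forall>\<^sub>F j in sequentially. \<forall>x\<in>K. equi_h \<phi> \<omega> F f j \<epsilon> x < ennreal \<delta>"
  proof eventually_elim
    case (elim j)
    show ?case
    proof
      fix x assume x: "x \<in> K"
      let ?U = "((E - {1..j}) \<union> (D 0 x - {1..j})) \<union> ((D 1 x - {1..j}) \<union> (D 2 x - {1..j}))"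
      have D: "D i x \<subseteq> {1..}" for i by (auto simp: D_def)
      have E: "E \<subseteq> {1..}" by (auto simp: E_def)
      have U: "?U \<subseteq> {1..}" using D[of 0] D[of 1] D[of 2] E by blast
      have "{t\<in>{1..}. \<omega> t * \<bar>F t x - f x\<bar> > \<epsilon>} - {1..j} \<subseteq> ?U"
        using cover[OF x] by blast
      then have "equi_h \<phi> \<omega> F f j \<epsilon> x \<le> \<phi> ?U"
        using sub U unfolding equi_h_def submeasure_def by blast
      also have "\<dots> < ennreal ((\<delta> / 4 + \<delta> / 4) + (\<delta> / 4 + \<delta> / 4))"
        using elim x \<open>\<delta> > 0\<close> D E U by (intro submeasure_Un_lt[OF sub]) auto
      finally show "equi_h \<phi> \<omega> F f j \<epsilon> x < ennreal \<delta>" by simp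
    qed
  qed
qed

section \<open>The Korovkin theorem\<close>

theorem theorem5p4:
  fixes \<phi> :: "nat set \<Rightarrow> ennreal"
    and \<omega> :: "nat \<Rightarrow> real"
    and K :: "real set"
    and L :: "nat \<Rightarrow> (real \<Rightarrow> real) \<Rightarrow> (real \<Rightarrow> real)"
  assumes "lsc_submeasure \<phi>"
    and "weighted_seq \<omega>"
    and "ideal_bounded \<phi> \<omega>"
    and "compact K"
    and "\<And>t. t \<ge> 1 \<Longrightarrow> positive_linear_operator_C K (L t)"
  shows "(\<forall>f\<in>C_space K. weighted_equi_convergent \<phi> \<omega> K (\<lambda>t. L t f) f) \<longleftrightarrow>
         (\<forall>i\<in>{0,1,2}. weighted_equi_convergent \<phi> \<omega> K
            (\<lambda>t. L t (monomial_C K i)) (monomial_C K i))"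
proof
  assume "\<forall>f\<in>C_space K. weighted_equi_convergent \<phi> \<omega> K (\<lambda>t. L t f) f"
  then show "\<forall>i\<in>{0,1,2}. weighted_equi_convergent \<phi> \<omega> K
      (\<lambda>t. L t (monomial_C K i)) (monomial_C K i)"
    using monomial_C_in_C_space by blast
next
  assume test: "\<forall>i\<in>{0,1,2}. weighted_equi_convergent \<phi> \<omega> K
    (\<lambda>t. L t (monomial_C K i)) (monomial_C K i)"
  have sub: "submeasure \<phi>" using assms(1) by (simp add: lsc_submeasure_def)
  show "\<forall>f\<in>C_space K. weighted_equi_convergent \<phi> \<omega> K (\<lambda>t. L t f) f"
  proof
    fix f assume f: "f \<in> C_space K"
    show "weighted_equi_convergent \<phi> \<omega> K (\<lambda>t. L t f) f"
    proof (rule weighted_equi_convergent_by_estimate[OF sub assms(2,3)])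
      show "weighted_equi_convergent \<phi> \<omega> K (\<lambda>t. L t (monomial_C K i)) (monomial_C K i)"
        if "i \<in> {0,1,2}" for i
        using test that by blast
      fix \<eta> :: real assume "\<eta> > 0"
      from korovkin_uniform_estimate[OF assms(4) f this]
      show "\<exists>B>0. \<forall>t\<ge>1. \<forall>x\<in>K. \<bar>L t f x - f x\<bar>
          \<le> \<eta> + B * (\<Sum>i\<le>2. \<bar>L t (monomial_C K i) x - monomial_C K i x\<bar>)"
        using assms(5) by metis
    qed
  qed
qed

end
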